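(* Let $\mathbb{F}$ be any field, let $G=([n],E)$ be a directed graph and $\mathcal{S}_G=\langle\mathrm{E}_{i,j}\mid (i,j)\in E\rangle\le\mathrm{M}(n,\mathbb{F})$. The maximum number of arcs in a spanning subgraph of $G$ that is not strongly connected equals the largest dimension of a reducible subspace of $\mathcal{S}_G$.
   Context: Directed graph: $E\subseteq[n]\times[n]$; a spanning subgraph has vertex set $[n]$ and arc set contained in $E$; strongly connected means there is a directed path between every ordered pair of vertices. Vectors in $\mathbb{F}^n$ are row vectors with matrices acting on the right, $B(U)=\{uB\mid u\in U\}$. A matrix space $\mathcal{S}\le\mathrm{M}(n,\mathbb{F})$ is reducible if there is a subspace $0\ne U<\mathbb{F}^n$ with $B(U)\le U$ for all $B\in\mathcal{S}$. $\mathrm{E}_{i,j}$ is the elementary matrix with $1$ at $(i,j)$. *)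

theory Defs
  imports
    "HOL-Analysis.Cartesian_Space"
    "Graph_Theory.Digraph_Component"
    "Graph_Theory.Pair_Digraph"
begin

text \<open>
  The vertex set \<open>[n]\<close> is a finite type \<open>'n\<close>, so \<open>n = CARD('n)\<close> is at least 1.
  Directed graphs may have loops.
\<close>

definition digraph_on :: "('n \<times> 'n) set \<Rightarrow> ('n, 'n \<times> 'n) pre_digraph" where
  "digraph_on E = with_proj \<lparr>pverts = UNIV, parcs = E\<rparr>"

definition non_strong_arc_counts :: "('n, 'n \<times> 'n) pre_digraph \<Rightarrow> nat set" where
  "non_strong_arc_counts G =
     {card (arcs H) | H. spanning H G \<and> \<not> strongly_connected H}"

text \<open>
  The library scales vectors by scalars of an arbitrary field, but matrices only by real numbers.
\<close>

definition matrix_scale :: "'a::field \<Rightarrow> 'a ^ 'n ^ 'm \<Rightarrow> 'a ^ 'n ^ 'm" where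
  "matrix_scale c A = (\<chi> i j. c * A $ i $ j)"

global_interpretation matsp: vector_space "matrix_scale :: 'a::field \<Rightarrow> 'a ^ 'n ^ 'm \<Rightarrow> 'a ^ 'n ^ 'm"
  by unfold_locales (simp_all add: matrix_scale_def vec_eq_iff algebra_simps)

definition elementary_matrix :: "'n \<Rightarrow> 'n \<Rightarrow> 'a::field ^ 'n ^ 'n" where
  "elementary_matrix i j = (\<chi> k l. if k = i \<and> l = j then 1 else 0)"

definition graphical_space :: "('n \<times> 'n) set \<Rightarrow> ('a::field ^ 'n ^ 'n) set" where
  "graphical_space E = matsp.span {elementary_matrix i j | i j. (i, j) \<in> E}"

text \<open>
  Vectors are row vectors and matrices act on the right.
\<close>

definition reducible_space :: "('a::field ^ 'n ^ 'n) set \<Rightarrow> bool" where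
  "reducible_space S \<longleftrightarrow>
     (\<exists>U. vec.subspace U \<and> U \<noteq> {0} \<and> U \<noteq> UNIV \<and> (\<forall>B\<in>S. (\<lambda>u. u v* B) ` U \<subseteq> U))"

definition reducible_dims :: "('a::field ^ 'n ^ 'n) set \<Rightarrow> nat set" where
  "reducible_dims S =
     {matsp.dim T | T. matsp.subspace T \<and> T \<subseteq> S \<and> reducible_space T}"

end

theory Submission
  imports Defs
begin

text \<open>
  Let \<open>U\<close> be invariant under a space \<open>T\<close> of matrices supported on \<open>E\<close>. A minimal set \<open>P\<close> of
  coordinates such that only the zero vector of \<open>U\<close> vanishes on \<open>P\<close> is nonempty and proper, and
  \<open>U\<close> contains for every \<open>p \<in> P\<close> a vector \<open>u\<^sub>p\<close> whose restriction to \<open>P\<close> is the \<open>p\<close>-th unit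
  vector. If \<open>B \<in> T\<close> is supported on \<open>P \<times> (- P)\<close>, then \<open>u\<^sub>p B\<close> is the \<open>p\<close>-th row of \<open>B\<close>, which
  lies in \<open>U\<close> and vanishes on \<open>P\<close>; so \<open>B = 0\<close>. Hence \<open>T\<close> meets the matrices supported on
  \<open>E \<inter> P \<times> (- P)\<close> trivially, and its dimension is at most the number of arcs in
  \<open>E - P \<times> (- P)\<close>, a set of arcs that does not leave \<open>P\<close>.
  Conversely, if a set \<open>A\<close> of arcs does not leave \<open>R\<close>, then the vectors supported on \<open>R\<close> are
  invariant under all matrices supported on \<open>A\<close>.
\<close>

section \<open>Strong connectivity in terms of arc sets and the vertex sets they do not
  leave\<close>

definition arcs_not_leaving :: "('n \<times> 'n) set \<Rightarrow> 'n set \<Rightarrow> bool" where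
  "arcs_not_leaving A R \<longleftrightarrow> (\<forall>(i, j)\<in>A. i \<in> R \<longrightarrow> j \<in> R)"

lemma arcs_not_leaving_rtrancl_on:
  assumes "(u, v) \<in> rtrancl_on V A" "arcs_not_leaving A R" "u \<in> R"
  shows "v \<in> R"
  using assms by (induction rule: rtrancl_on_induct) (auto simp: arcs_not_leaving_def)

lemma strongly_connected_digraph_on_iff:
  "strongly_connected (digraph_on A) \<longleftrightarrow> (\<forall>R. arcs_not_leaving A R \<longrightarrow> R = {} \<or> R = UNIV)"
proof
  assume "strongly_connected (digraph_on A)"
  then have reach: "(u, v) \<in> rtrancl_on UNIV A" for u v
    by (simp add: strongly_connected_def reachable_def digraph_on_def)
  have "v \<in> R" if "arcs_not_leaving A R" "u \<in> R" for R u v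
    using reach that by (rule arcs_not_leaving_rtrancl_on)
  then show "\<forall>R. arcs_not_leaving A R \<longrightarrow> R = {} \<or> R = UNIV"
    by blast
next
  assume *: "\<forall>R. arcs_not_leaving A R \<longrightarrow> R = {} \<or> R = UNIV"
  have "(u, v) \<in> rtrancl_on UNIV A" for u v
  proof -
    \<comment> \<open>The set of vertices reachable from \<open>u\<close> is not left by
      \<open>A\<close> and contains \<open>u\<close>, so the hypothesis makes it the whole vertex
      set.\<close>
    let ?R = "{w. (u, w) \<in> rtrancl_on UNIV A}"
    have "arcs_not_leaving A ?R"
      by (auto simp: arcs_not_leaving_def intro: rtrancl_on_into_rtrancl_on)
    moreover have "u \<in> ?R" by simp
    ultimately have "?R = UNIV" using * by (metis empty_iff)
    then show ?thesis by blast
  qed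
  then show "strongly_connected (digraph_on A)"
    by (simp add: strongly_connected_def reachable_def digraph_on_def)
qed

lemma spanning_digraph_on_iff:
  "spanning H (digraph_on E) \<longleftrightarrow> (\<exists>A\<subseteq>E. H = digraph_on A)"
proof
  assume "spanning H (digraph_on E)"
  \<comment> \<open>Compatibility fixes \<open>tail\<close> and \<open>head\<close>, and spanning
    fixes the vertices, so only the arc set is free.\<close>
  then have "H = digraph_on (arcs H)" "arcs H \<subseteq> E"
    by (auto simp: spanning_def subgraph_def digraph_on_def with_proj_def compatible_def)
  then show "\<exists>A\<subseteq>E. H = digraph_on A" by blast
next
  assume "\<exists>A\<subseteq>E. H = digraph_on A"
  then show "spanning H (digraph_on E)"
    by (auto simp: spanning_def subgraph_def digraph_on_def compatible_def wf_digraph_def)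
qed

lemma arcs_digraph_on [simp]: "arcs (digraph_on A) = A"
  by (simp add: digraph_on_def)

lemma non_strong_arc_counts_eq:
  "non_strong_arc_counts (digraph_on E) =
     {card A | A R. A \<subseteq> E \<and> arcs_not_leaving A R \<and> R \<noteq> {} \<and> R \<noteq> UNIV}"
  (is "_ = ?N")
proof
  show "non_strong_arc_counts (digraph_on E) \<subseteq> ?N"
  proof
    fix k assume "k \<in> non_strong_arc_counts (digraph_on E)"
    then obtain A where "k = card A" "A \<subseteq> E" "\<not> strongly_connected (digraph_on A)"
      unfolding non_strong_arc_counts_def spanning_digraph_on_iff by auto
    then show "k \<in> ?N" unfolding strongly_connected_digraph_on_iff by blast
  qed
  show "?N \<subseteq> non_strong_arc_counts (digraph_on E)"
  proof clarify
    fix A R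
    assume "A \<subseteq> E" "arcs_not_leaving A R" "R \<noteq> {}" "R \<noteq> UNIV"
    then have "spanning (digraph_on A) (digraph_on E)" "\<not> strongly_connected (digraph_on A)"
      by (auto simp: spanning_digraph_on_iff strongly_connected_digraph_on_iff)
    then show "card A \<in> non_strong_arc_counts (digraph_on E)"
      unfolding non_strong_arc_counts_def by (intro CollectI exI[of _ "digraph_on A"] conjI) simp_all
  qed
qed

section \<open>Matrices with prescribed support and their dimension\<close>

lemma matrix_scale_nth [simp]: "matrix_scale c A $ i $ j = c * A $ i $ j"
  by (simp add: matrix_scale_def)

lemma elementary_matrix_nth:
  "elementary_matrix i j $ k $ l = (if k = i \<and> l = j then 1 else 0)"
  by (simp add: elementary_matrix_def)

lemma matrix_eq_sum_elementary:
  fixes B :: "'a::field ^ 'n::finite ^ 'n"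
  assumes "\<And>i j. (i, j) \<notin> E \<Longrightarrow> B $ i $ j = 0"
  shows "B = (\<Sum>(i, j)\<in>E. matrix_scale (B $ i $ j) (elementary_matrix i j))"
proof -
  have "(\<Sum>(i, j)\<in>E. matrix_scale (B $ i $ j) (elementary_matrix i j)) $ k $ l = B $ k $ l" for k l
  proof -
    have "(\<Sum>(i, j)\<in>E. matrix_scale (B $ i $ j) (elementary_matrix i j)) $ k $ l
        = (\<Sum>e\<in>E. (case e of (i, j) \<Rightarrow> matrix_scale (B $ i $ j) (elementary_matrix i j)) $ k $ l)"
      by simp
    also have "\<dots> = (\<Sum>e\<in>E. if e = (k, l) then B $ k $ l else 0)"
      by (intro sum.cong) (auto simp: elementary_matrix_nth split: if_splits)
    finally show ?thesis using assms by (simp add: sum.delta)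
  qed
  then show ?thesis by (simp add: vec_eq_iff)
qed

text \<open>Replaces the span by an entrywise condition, so that inclusions and intersections of
  graphical spaces can be read off from the arc sets.\<close>

lemma graphical_space_eq:
  "graphical_space E =
     {B :: 'a::field ^ 'n::finite ^ 'n. \<forall>i j. (i, j) \<notin> E \<longrightarrow> B $ i $ j = 0}" (is "_ = ?S")
proof
  have "matsp.subspace ?S"
    by (auto simp: matsp.subspace_def)
  then show "graphical_space E \<subseteq> ?S"
    unfolding graphical_space_def by (rule matsp.span_minimal[rotated])
      (auto simp: elementary_matrix_nth)
  show "?S \<subseteq> graphical_space E"
  proof
    fix B assume "B \<in> ?S"
    then have "B = (\<Sum>(i, j)\<in>E. matrix_scale (B $ i $ j) (elementary_matrix i j))"
      by (intro matrix_eq_sum_elementary) simp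
    also have "\<dots> \<in> graphical_space E"
      unfolding graphical_space_def
      by (rule matsp.span_sum, clarify) (rule matsp.span_scale, rule matsp.span_base, blast)
    finally show "B \<in> graphical_space E" .
  qed
qed

lemma subspace_graphical_space: "matsp.subspace (graphical_space E)"
  unfolding graphical_space_def by (rule matsp.subspace_span)

lemma inj_elementary_matrix:
  "inj (\<lambda>(i, j). elementary_matrix i j :: 'a::field ^ 'n ^ 'n)"
proof (rule injI, clarify)
  fix i j k l :: 'n
  assume "(elementary_matrix i j :: 'a ^ 'n ^ 'n) = elementary_matrix k l"
  then have "(elementary_matrix i j :: 'a ^ 'n ^ 'n) $ i $ j = elementary_matrix k l $ i $ j"
    by simp
  then show "i = k \<and> j = l"
    by (simp add: elementary_matrix_nth split: if_splits)
qed

lemma independent_elementary_matrices: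
  "matsp.independent ((\<lambda>(i, j). elementary_matrix i j :: 'a::field ^ 'n::finite ^ 'n) ` E)"
proof (rule matsp.independent_if_scalars_zero)
  let ?M = "\<lambda>(i, j). elementary_matrix i j :: 'a ^ 'n ^ 'n"
  fix f B
  assume 0: "(\<Sum>x\<in>?M ` E. matrix_scale (f x) x) = 0" and "B \<in> ?M ` E"
  then obtain k l where kl: "(k, l) \<in> E" "B = elementary_matrix k l" by auto
  \<comment> \<open>The entry at \<open>(k, l)\<close> isolates the coefficient of
    \<open>elementary_matrix k l\<close>.\<close>
  have "(\<Sum>x\<in>?M ` E. matrix_scale (f x) x) $ k $ l
      = (\<Sum>e\<in>E. matrix_scale (f (?M e)) (?M e) $ k $ l)"
    by (simp add: sum.reindex[OF inj_on_subset[OF inj_elementary_matrix]])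
  also have "\<dots> = (\<Sum>e\<in>E. if e = (k, l) then f B else 0)"
    using kl by (intro sum.cong) (auto simp: elementary_matrix_nth split: if_splits)
  also have "\<dots> = f B" using kl by (simp add: sum.delta)
  finally show "f B = 0" using 0 by simp
qed simp

lemma graphical_space_UNIV: "graphical_space UNIV = (UNIV :: ('a::field ^ 'n::finite ^ 'n) set)"
  by (simp add: graphical_space_eq)

text \<open>Finite dimensionality gives the dimension formula for sums and the monotonicity of the
  dimension, both used to bound \<open>matsp.dim T\<close>.\<close>

global_interpretation matfd: finite_dimensional_vector_space
  "matrix_scale :: 'a::field \<Rightarrow> 'a ^ 'n::finite ^ 'n \<Rightarrow> 'a ^ 'n ^ 'n"
  "range (\<lambda>(i, j). elementary_matrix i j)"
proof
  show "matsp.independent (range (\<lambda>(i, j). elementary_matrix i j :: 'a ^ 'n ^ 'n))"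
    by (rule independent_elementary_matrices)
  have "range (\<lambda>(i, j). elementary_matrix i j :: 'a ^ 'n ^ 'n) =
      {elementary_matrix i j | i j. (i, j) \<in> UNIV}"
    by auto
  then show "matsp.span (range (\<lambda>(i, j). elementary_matrix i j :: 'a ^ 'n ^ 'n)) = UNIV"
    using graphical_space_UNIV[where ?'a = 'a and ?'n = 'n] by (simp add: graphical_space_def)
qed simp

lemma dim_graphical_space:
  "matsp.dim (graphical_space E :: ('a::field ^ 'n::finite ^ 'n) set) = card E"
proof -
  let ?M = "\<lambda>(i, j). elementary_matrix i j :: 'a ^ 'n ^ 'n"
  have "?M ` E = {elementary_matrix i j | i j. (i, j) \<in> E}" by force
  then have "graphical_space E = matsp.span (?M ` E)"
    by (simp add: graphical_space_def)
  then have "matsp.dim (graphical_space E :: ('a ^ 'n ^ 'n) set) = card (?M ` E)"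
    using matsp.dim_span_eq_card_independent[OF independent_elementary_matrices] by metis
  also have "\<dots> = card E"
    by (rule card_image[OF inj_on_subset[OF inj_elementary_matrix]]) simp
  finally show ?thesis .
qed

section \<open>Passing between arc sets and reducible spaces\<close>

lemma reducible_graphical_space:
  fixes A :: "('n::finite \<times> 'n) set"
  assumes "arcs_not_leaving A R" "R \<noteq> {}" "R \<noteq> UNIV"
  shows "reducible_space (graphical_space A :: ('a::field ^ 'n ^ 'n) set)"
  unfolding reducible_space_def
proof (intro exI conjI ballI)
  let ?U = "{u :: 'a ^ 'n. \<forall>i. i \<notin> R \<longrightarrow> u $ i = 0}"
  show "vec.subspace ?U" by (auto simp: vec.subspace_def)
  obtain r where "r \<in> R" using assms by blast
  then have "axis r 1 \<in> ?U" by (auto simp: axis_def)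
  moreover have "axis r (1 :: 'a) \<noteq> 0" by (simp add: axis_eq_0_iff)
  ultimately show "?U \<noteq> {0}" by blast
  obtain q where "q \<notin> R" using assms by blast
  then have "axis q 1 \<notin> ?U" by (auto simp: axis_def)
  then show "?U \<noteq> UNIV" by blast
  fix B :: "'a ^ 'n ^ 'n"
  assume "B \<in> graphical_space A"
  then have B: "B $ i $ j = 0" if "(i, j) \<notin> A" for i j
    using that by (simp add: graphical_space_eq)
  show "(\<lambda>u. u v* B) ` ?U \<subseteq> ?U"
  proof clarify
    fix u :: "'a ^ 'n" and j
    assume u: "\<forall>i. i \<notin> R \<longrightarrow> u $ i = 0" and "j \<notin> R"
    \<comment> \<open>If \<open>i\<close> lies in \<open>R\<close>, then \<open>(i, j)\<close> would
      leave \<open>R\<close>, so it is not in \<open>A\<close> and the entry of \<open>B\<close>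
      vanishes.\<close>
    then have "u $ i = 0 \<or> B $ i $ j = 0" for i
      using B[of i j] assms(1) by (auto simp: arcs_not_leaving_def)
    then show "(u v* B) $ j = 0"
      by (auto simp: vector_matrix_mult_def intro!: sum.neutral)
  qed
qed

text \<open>\<open>P\<close> acts like the pivot columns of a reduced echelon basis of
  \<open>U\<close>: restriction to \<open>P\<close> is injective on \<open>U\<close> by the first
  property and onto by the second.\<close>

lemma exists_pivot_set:
  fixes U :: "('a::field ^ 'n::finite) set"
  assumes "vec.subspace U"
  obtains P where "\<And>u. u \<in> U \<Longrightarrow> (\<And>p. p \<in> P \<Longrightarrow> u $ p = 0) \<Longrightarrow> u = 0"
    and "\<And>p. p \<in> P \<Longrightarrow> \<exists>u\<in>U. u $ p = 1 \<and> (\<forall>q\<in>P - {p}. u $ q = 0)"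
proof -
  define detects where "detects P \<longleftrightarrow> (\<forall>u\<in>U. (\<forall>p\<in>P. u $ p = 0) \<longrightarrow> u = 0)" for P
  have "detects UNIV" by (auto simp: detects_def vec_eq_iff)
  \<comment> \<open>The full coordinate set detects, so induction on finite sets yields a minimal
    detecting set.\<close>
  then obtain P where P: "detects P" and min: "\<And>Q. Q \<subset> P \<Longrightarrow> \<not> detects Q"
    using finite_psubset_induct[of UNIV "\<lambda>P. detects P \<longrightarrow> (\<exists>P. detects P \<and> (\<forall>Q\<subset>P. \<not> detects Q))"]
    by auto
  show thesis
  proof
    show "u = 0" if "u \<in> U" "\<And>p. p \<in> P \<Longrightarrow> u $ p = 0" for u
      using P that unfolding detects_def by blast
    fix p assume p: "p \<in> P"
    \<comment> \<open>By minimality some nonzero \<open>u\<close> in \<open>U\<close> vanishes on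
      \<open>P - {p}\<close>; since \<open>P\<close> detects, its entry at \<open>p\<close> is
      nonzero and can be scaled to 1.\<close>
    then have "\<not> detects (P - {p})" by (intro min) auto
    then obtain u where u: "u \<in> U" "u \<noteq> 0" "\<forall>q\<in>P - {p}. u $ q = 0"
      unfolding detects_def by blast
    with P have "u $ p \<noteq> 0" unfolding detects_def by blast
    moreover have "inverse (u $ p) *s u \<in> U"
      using assms u(1) by (rule vec.subspace_scale)
    ultimately show "\<exists>u\<in>U. u $ p = 1 \<and> (\<forall>q\<in>P - {p}. u $ q = 0)"
      using u(3) by (intro bexI[of _ "inverse (u $ p) *s u"]) auto
  qed
qed

lemma exists_arc_set_of_reducible:
  fixes T :: "('a::field ^ 'n::finite ^ 'n) set"
  assumes T: "matsp.subspace T" "T \<subseteq> graphical_space E" and "reducible_space T"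
  obtains P where "P \<noteq> {}" "P \<noteq> UNIV" "matsp.dim T \<le> card (E - P \<times> (- P))"
proof -
  obtain U where U: "vec.subspace U" "U \<noteq> {0}" "U \<noteq> UNIV"
    and inv: "\<And>B u. B \<in> T \<Longrightarrow> u \<in> U \<Longrightarrow> u v* B \<in> U"
    using assms(3) unfolding reducible_space_def by blast
  obtain P where P0: "\<And>u. u \<in> U \<Longrightarrow> (\<And>p. p \<in> P \<Longrightarrow> u $ p = 0) \<Longrightarrow> u = 0"
    and P1: "\<And>p. p \<in> P \<Longrightarrow> \<exists>u\<in>U. u $ p = 1 \<and> (\<forall>q\<in>P - {p}. u $ q = 0)"
    using exists_pivot_set[OF U(1)] by blast
  have "P \<noteq> {}"
  proof
    assume "P = {}"
    then have "u = 0" if "u \<in> U" for u using P0[OF that] by simp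
    then show False using U(2) vec.subspace_0[OF U(1)] by blast
  qed
  have "P \<noteq> UNIV"
  proof
    assume "P = UNIV"
    \<comment> \<open>With all coordinates in \<open>P\<close>, the vectors supplied by
      \<open>P1\<close> are the unit vectors themselves, which would force \<open>U\<close> to be
      everything.\<close>
    have "axis p 1 \<in> U" for p
    proof -
      obtain u where "u \<in> U" "u $ p = 1" "\<forall>q\<in>P - {p}. u $ q = 0"
        using P1[of p] \<open>P = UNIV\<close> by auto
      moreover from this have "u = axis p 1"
        using \<open>P = UNIV\<close> by (auto simp: vec_eq_iff axis_def)
      ultimately show ?thesis by simp
    qed
    then have "(\<Sum>p\<in>UNIV. x $ p *s axis p 1) \<in> U" for x
      using U(1) by (intro vec.subspace_sum vec.subspace_scale)
    then show False using U(3) by (auto simp: basis_expansion)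
  qed
  let ?C = "E \<inter> P \<times> (- P)"
  let ?S = "graphical_space ?C :: ('a ^ 'n ^ 'n) set"
  have "B = 0" if "B \<in> T" "B \<in> ?S" for B
  proof -
    have B: "B $ i $ j = 0" if "i \<notin> P \<or> j \<in> P" for i j
      using \<open>B \<in> ?S\<close> that by (auto simp: graphical_space_eq)
    have "row p B = 0" if p: "p \<in> P" for p
    proof -
      obtain u where u: "u \<in> U" "u $ p = 1" "\<forall>q\<in>P - {p}. u $ q = 0"
        using P1[OF p] by blast
      \<comment> \<open>Only \<open>i = p\<close> contributes: \<open>u\<close> vanishes on the rest
        of \<open>P\<close>, and the rows of \<open>B\<close> outside \<open>P\<close> are
        zero.\<close>
      have "(\<Sum>i\<in>UNIV. u $ i * B $ i $ j) = (\<Sum>i\<in>UNIV. if i = p then B $ p $ j else 0)" for j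
        using u B by (intro sum.cong) auto
      then have "u v* B = row p B"
        by (simp add: vec_eq_iff vector_matrix_mult_def row_def mult.commute)
      then have "row p B \<in> U" using inv[OF \<open>B \<in> T\<close> u(1)] by simp
      then show ?thesis
        by (rule P0) (simp add: row_def B)
    qed
    then have "B $ i $ j = 0" for i j
      using B by (cases "i \<in> P") (auto simp: row_def vec_eq_iff)
    then show ?thesis by (simp add: vec_eq_iff)
  qed
  moreover have "0 \<in> T" "0 \<in> ?S"
    using matsp.subspace_0 T(1) subspace_graphical_space by blast+
  ultimately have "T \<inter> ?S = {0}" by blast
  then have "matsp.dim T + matsp.dim ?S = matsp.dim {x + y | x y. x \<in> T \<and> y \<in> ?S}"
    using matfd.dim_sums_Int[OF T(1) subspace_graphical_space[of ?C]] by simp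
  also have "\<dots> \<le> matsp.dim (graphical_space E :: ('a ^ 'n ^ 'n) set)"
  proof (rule matfd.dim_subset)
    have "?S \<subseteq> graphical_space E" by (auto simp: graphical_space_eq)
    then show "{x + y | x y. x \<in> T \<and> y \<in> ?S} \<subseteq> graphical_space E"
      using T(2) matsp.subspace_add[OF subspace_graphical_space[of E]] by blast
  qed
  finally have "matsp.dim T + card ?C \<le> card E"
    by (simp add: dim_graphical_space)
  then have "matsp.dim T \<le> card (E - P \<times> (- P))"
    by (simp add: card_Diff_subset_Int)
  with that \<open>P \<noteq> {}\<close> \<open>P \<noteq> UNIV\<close> show thesis by blast
qed

section \<open>Comparison of the two maxima\<close>

theorem theorem1p13:
  fixes E :: "('n::finite \<times> 'n) set"
  defines "N \<equiv> non_strong_arc_counts (digraph_on E)"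
    and "D \<equiv> reducible_dims (graphical_space E :: ('a::field ^ 'n ^ 'n) set)"
  shows "finite N \<and> finite D \<and> (N = {} \<longleftrightarrow> D = {}) \<and> Max N = Max D"
proof -
  have "N \<subseteq> {..card E}"
    unfolding N_def non_strong_arc_counts_eq using card_mono[OF finite[of E]] by blast
  then have finN: "finite N" by (rule finite_subset) simp
  have "N \<subseteq> D"
  proof
    fix k assume "k \<in> N"
    then obtain A R where A: "k = card A" "A \<subseteq> E" "arcs_not_leaving A R" "R \<noteq> {}" "R \<noteq> UNIV"
      by (auto simp: N_def non_strong_arc_counts_eq)
    have "(graphical_space A :: ('a ^ 'n ^ 'n) set) \<subseteq> graphical_space E"
      using A(2) by (auto simp: graphical_space_eq)
    then show "k \<in> D"
      unfolding D_def reducible_dims_def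
      using A(1) reducible_graphical_space[OF A(3-5), where ?'a = 'a]
      by (intro CollectI exI[of _ "graphical_space A"])
        (simp add: dim_graphical_space subspace_graphical_space)
  qed
  \<comment> \<open>Domination suffices for the converse direction: it bounds \<open>D\<close>,
    makes \<open>D\<close> empty when \<open>N\<close> is, and gives
    \<open>Max D \<le> Max N\<close>.\<close>
  have dom: "\<exists>k\<in>N. d \<le> k" if "d \<in> D" for d
  proof -
    obtain T :: "('a ^ 'n ^ 'n) set" where T: "matsp.subspace T" "T \<subseteq> graphical_space E"
      "reducible_space T" and d: "d = matsp.dim T"
      using \<open>d \<in> D\<close> by (auto simp: D_def reducible_dims_def)
    obtain P where P: "P \<noteq> {}" "P \<noteq> UNIV" "matsp.dim T \<le> card (E - P \<times> (- P))"
      by (rule exists_arc_set_of_reducible[OF T])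
    moreover have "arcs_not_leaving (E - P \<times> (- P)) P"
      by (auto simp: arcs_not_leaving_def)
    ultimately have "card (E - P \<times> (- P)) \<in> N"
      unfolding N_def non_strong_arc_counts_eq by blast
    with P d show ?thesis by blast
  qed
  have "D \<subseteq> {..card E}"
    using dom \<open>N \<subseteq> {..card E}\<close> by force
  then have finD: "finite D" by (rule finite_subset) simp
  have empty: "N = {} \<longleftrightarrow> D = {}" using \<open>N \<subseteq> D\<close> dom by blast
  have "Max N = Max D"
  proof (cases "N = {}")
    case False
    have "Max D \<in> D" using False empty finD by (intro Max_in) auto
    then obtain k where "k \<in> N" "Max D \<le> k" using dom by blast
    then have "Max D \<le> Max N" using Max_ge[OF finN] order_trans by blast
    moreover have "Max N \<le> Max D"
      using \<open>N \<subseteq> D\<close> False finD by (rule Max_mono)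
    ultimately show ?thesis by simp
  \<comment> \<open>With a single vertex no \<open>R\<close> is both nonempty and proper; then
    \<open>N\<close> and \<open>D\<close> are empty and both sides are the same term
    \<open>Max {}\<close>.\<close>
  qed (use empty in simp)
  with finN finD empty show ?thesis by blast
qed

end
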